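(* Let $(\Omega,\mathcal F,\mathbb P)$ be a standard probability space, $\theta:\Omega\to\Omega$ an invertible, bimeasurable, measure-preserving transformation, $H$ a real separable Hilbert space, and $\mathscr H=L^2(\Omega;H)$. Let $S\subset\mathbb Z$ be finite and $F_S=\{0\}\cup S\cup(S+S)$, where $S+S=\{s+t:s,t\in S\}$. Assume $\mathbb P\{\omega:\theta^a\omega=\theta^b\omega\}=0$ for all $a,b\in F_S$ with $a\ne b$. Let $T:\mathscr H\to\mathscr H$ be a finite $S$-memory map. If there exists $\Psi\in C^1(\mathscr H)$ (real-valued, on all of $\mathscr H$) such that $T=\nabla\Psi$, then $$\operatorname{Act}(T)=-\operatorname{Act}(T).$$ In particular, every active lag $k$ forces the reverse lag $-k$ to be present (i.e. $-k\in S$) and active.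
   Context: A continuous map $T:\mathscr H\to\mathscr H$ is a finite $S$-memory map if it admits a Carathéodory representation $(Tu)(\omega)=t_\omega\bigl((u(\theta^s\omega))_{s\in S}\bigr)$ (a.e. $\omega$, for every $u\in\mathscr H$), where $t_\omega:H^S\to H$ is continuous for a.e. $\omega$ and $\omega\mapsto t_\omega(z)$ is measurable for each fixed $z\in H^S$. For $k\in S$, the $k$th lag is inactive if, outside one null set of $\omega$, $t_\omega$ is independent of its $k$th coordinate; otherwise $k$ is active. Equivalently, fixing a countable dense set $D\subset H$, $k$ is active iff for some two tuples in $D^S$ differing only in the $k$th coordinate, the corresponding outputs of $t_\omega$ differ on a set of $\omega$ of positive measure. $\operatorname{Act}(T)=\{k\in S:k\text{ is active}\}$, and $-\operatorname{Act}(T)=\{-k:k\in\operatorname{Act}(T)\}$. *)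

theory Defs
  imports "HOL-Probability.Probability"
begin

definition standard_borel_space :: "'w measure \<Rightarrow> bool" where
  "standard_borel_space M \<longleftrightarrow>
     (\<exists>X. topspace X = space M \<and> completely_metrizable_space X \<and> second_countable X \<and>
          sets M = sigma_sets (space M) {U. openin X U})"

(* Covers the usual conventions at once: standard Borel with a Borel probability, the completion
   of such a space, and Lebesgue-Rokhlin spaces (the latter only up to a null set Z). *)
definition standard_prob_space :: "'w measure \<Rightarrow> bool" where
  "standard_prob_space M \<longleftrightarrow> prob_space M \<and>
     (\<exists>Z\<in>null_sets M.
        standard_borel_space (restrict_space M (space M - Z)) \<or>
        (\<exists>N. standard_borel_space N \<and> restrict_space M (space M - Z) = completion N))"

definition invertible_mpt :: "'w measure \<Rightarrow> ('w \<Rightarrow> 'w) \<Rightarrow> bool" where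
  "invertible_mpt M \<theta> \<longleftrightarrow>
     bij_betw \<theta> (space M) (space M) \<and>
     \<theta> \<in> M \<rightarrow>\<^sub>M M \<and> the_inv_into (space M) \<theta> \<in> M \<rightarrow>\<^sub>M M \<and>
     distr M M \<theta> = M"

definition iter :: "'w measure \<Rightarrow> ('w \<Rightarrow> 'w) \<Rightarrow> int \<Rightarrow> 'w \<Rightarrow> 'w" where
  "iter M \<theta> s =
     (if s \<ge> 0 then \<theta> ^^ nat s else the_inv_into (space M) \<theta> ^^ nat (- s))"

(* Elements of the space of H-valued square integrable functions are handled through their
   representatives.  Functionals and operators on it are functions of representatives that are
   required to respect equality almost everywhere. *)
definition L2 :: "'w measure \<Rightarrow> ('w \<Rightarrow> 'h::{real_inner, banach, second_countable_topology}) set" where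
  "L2 M = {u. u \<in> borel_measurable M \<and> integrable M (\<lambda>\<omega>. (norm (u \<omega>))\<^sup>2)}"

definition L2_inner :: "'w measure \<Rightarrow> ('w \<Rightarrow> 'h::{real_inner, banach, second_countable_topology}) \<Rightarrow> ('w \<Rightarrow> 'h) \<Rightarrow> real" where
  "L2_inner M u v = (\<integral>\<omega>. u \<omega> \<bullet> v \<omega> \<partial>M)"

definition L2_norm :: "'w measure \<Rightarrow> ('w \<Rightarrow> 'h::{real_inner, banach, second_countable_topology}) \<Rightarrow> real" where
  "L2_norm M u = sqrt (L2_inner M u u)"

definition L2_functional ::
  "'w measure \<Rightarrow> (('w \<Rightarrow> 'h::{real_inner, banach, second_countable_topology}) \<Rightarrow> real) \<Rightarrow> bool" where
  "L2_functional M \<Psi> \<longleftrightarrow>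
     (\<forall>u\<in>L2 M. \<forall>v\<in>L2 M. (AE \<omega> in M. u \<omega> = v \<omega>) \<longrightarrow> \<Psi> u = \<Psi> v)"

definition L2_operator ::
  "'w measure \<Rightarrow> (('w \<Rightarrow> 'h::{real_inner, banach, second_countable_topology}) \<Rightarrow> 'w \<Rightarrow> 'h) \<Rightarrow> bool" where
  "L2_operator M T \<longleftrightarrow>
     (\<forall>u\<in>L2 M. T u \<in> L2 M) \<and>
     (\<forall>u\<in>L2 M. \<forall>v\<in>L2 M. (AE \<omega> in M. u \<omega> = v \<omega>) \<longrightarrow> (AE \<omega> in M. T u \<omega> = T v \<omega>))"

definition L2_continuous ::
  "'w measure \<Rightarrow> (('w \<Rightarrow> 'h::{real_inner, banach, second_countable_topology}) \<Rightarrow> 'w \<Rightarrow> 'h) \<Rightarrow> bool" where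
  "L2_continuous M T \<longleftrightarrow> L2_operator M T \<and>
     (\<forall>u\<in>L2 M. \<forall>\<epsilon>>0. \<exists>\<delta>>0. \<forall>v\<in>L2 M.
        L2_norm M (\<lambda>\<omega>. v \<omega> - u \<omega>) < \<delta> \<longrightarrow> L2_norm M (\<lambda>\<omega>. T v \<omega> - T u \<omega>) < \<epsilon>)"

(* Frechet differentiability at u, the derivative being the inner product with g *)
definition has_L2_gradient ::
  "'w measure \<Rightarrow> (('w \<Rightarrow> 'h::{real_inner, banach, second_countable_topology}) \<Rightarrow> real) \<Rightarrow>
   ('w \<Rightarrow> 'h) \<Rightarrow> ('w \<Rightarrow> 'h) \<Rightarrow> bool" where
  "has_L2_gradient M \<Psi> u g \<longleftrightarrow> g \<in> L2 M \<and>
     (\<forall>\<epsilon>>0. \<exists>\<delta>>0. \<forall>h\<in>L2 M. L2_norm M h < \<delta> \<longrightarrow>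
        \<bar>\<Psi> (\<lambda>\<omega>. u \<omega> + h \<omega>) - \<Psi> u - L2_inner M g h\<bar> \<le> \<epsilon> * L2_norm M h)"

(* By Riesz duality, continuity of the derivative in operator norm is continuity of the gradient. *)
definition L2_C1 ::
  "'w measure \<Rightarrow> (('w \<Rightarrow> 'h::{real_inner, banach, second_countable_topology}) \<Rightarrow> real) \<Rightarrow> bool" where
  "L2_C1 M \<Psi> \<longleftrightarrow> L2_functional M \<Psi> \<and>
     (\<exists>G. L2_continuous M G \<and> (\<forall>u\<in>L2 M. has_L2_gradient M \<Psi> u (G u)))"

(* Tuples in H^S are the extensional functions on S, with the product topology. *)
definition caratheodory_rep ::
  "'w measure \<Rightarrow> ('w \<Rightarrow> 'w) \<Rightarrow> int set \<Rightarrow>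
   (('w \<Rightarrow> 'h::{real_inner, banach, second_countable_topology}) \<Rightarrow> 'w \<Rightarrow> 'h) \<Rightarrow>
   ('w \<Rightarrow> (int \<Rightarrow> 'h) \<Rightarrow> 'h) \<Rightarrow> bool" where
  "caratheodory_rep M \<theta> S T t \<longleftrightarrow>
     (AE \<omega> in M. continuous_map (product_topology (\<lambda>_. euclidean) S) euclidean (t \<omega>)) \<and>
     (\<forall>z\<in>S \<rightarrow>\<^sub>E UNIV. (\<lambda>\<omega>. t \<omega> z) \<in> borel_measurable M) \<and>
     (\<forall>u\<in>L2 M. AE \<omega> in M. T u \<omega> = t \<omega> (\<lambda>s\<in>S. u (iter M \<theta> s \<omega>)))"

definition finite_memory_map ::
  "'w measure \<Rightarrow> ('w \<Rightarrow> 'w) \<Rightarrow> int set \<Rightarrow>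
   (('w \<Rightarrow> 'h::{real_inner, banach, second_countable_topology}) \<Rightarrow> 'w \<Rightarrow> 'h) \<Rightarrow> bool" where
  "finite_memory_map M \<theta> S T \<longleftrightarrow>
     finite S \<and> L2_continuous M T \<and> (\<exists>t. caratheodory_rep M \<theta> S T t)"

definition inactive_lag ::
  "'w measure \<Rightarrow> int set \<Rightarrow> ('w \<Rightarrow> (int \<Rightarrow> 'h) \<Rightarrow> 'h) \<Rightarrow> int \<Rightarrow> bool" where
  "inactive_lag M S t k \<longleftrightarrow>
     (AE \<omega> in M. \<forall>z\<in>S \<rightarrow>\<^sub>E UNIV. \<forall>z'\<in>S \<rightarrow>\<^sub>E UNIV.
        (\<forall>s\<in>S - {k}. z s = z' s) \<longrightarrow> t \<omega> z = t \<omega> z')"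

(* The set of active lags, read off from a Caratheodory representation t of the map. *)
definition Act :: "'w measure \<Rightarrow> int set \<Rightarrow> ('w \<Rightarrow> (int \<Rightarrow> 'h) \<Rightarrow> 'h) \<Rightarrow> int set" where
  "Act M S t = {k\<in>S. \<not> inactive_lag M S t k}"

definition F_set :: "int set \<Rightarrow> int set" where
  "F_set S = {0} \<union> S \<union> {s + t | s t. s \<in> S \<and> t \<in> S}"

end

theory Submission
  imports Defs
begin

text \<open>
  The derivative of a gradient map is symmetric: if moving the argument in direction \<open>p\<close> never
  changes the component of \<open>T\<close> along \<open>q\<close>, then moving it in direction \<open>q\<close> does not change the
  component along \<open>p\<close> (lemma \<open>gradient_no_one_way_influence\<close>).  Although \<open>T\<close> itself need not
  be differentiable, the symmetry can be read off from the second differences of the potential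
  \<open>\<Psi>\<close>.

  Suppose that lag \<open>-k\<close> is inactive or absent.  Let \<open>A\<close> be a set whose translates
  \<open>\<theta>\<^sup>a A\<close>, with \<open>a\<close> in \<open>F_set S\<close>, are pairwise disjoint, let \<open>p\<close> vanish outside \<open>A\<close>, and
  let \<open>q\<close> vanish outside \<open>\<theta>\<^sup>k A\<close>.  At a point \<open>\<theta>\<^sup>k \<alpha>\<close> with \<open>\<alpha>\<close> in \<open>A\<close>, the map \<open>T\<close> reads
  its argument at the points \<open>\<theta>\<^sup>s\<^sup>+\<^sup>k \<alpha>\<close>, and by disjointness such a point can lie in \<open>A\<close> only
  for \<open>s = -k\<close>, a lag that is not felt.  So \<open>p\<close> does not influence \<open>T\<close> on \<open>\<theta>\<^sup>k A\<close>, and by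
  symmetry \<open>q\<close> does not influence \<open>T\<close> on \<open>A\<close>.  There, however, \<open>q\<close> is seen exactly through
  lag \<open>k\<close>, while the background argument can be chosen to present any prescribed tuple at the
  points of \<open>A\<close>.  Hence \<open>t \<omega>\<close> takes the same value, for almost all \<open>\<omega>\<close> in \<open>A\<close>, at any two
  given tuples differing in coordinate \<open>k\<close> alone (lemma \<open>gradient_inactive_lag_reverse_on\<close>).

  In a standard space almost every point lies in one of countably many such sets \<open>A\<close>
  (lemma \<open>countable_cover_disjoint_translates\<close>), and by continuity of \<open>t \<omega>\<close> it is enough to
  consider tuples from a countable dense set.  Both exceptional sets are thus countable unions of
  null sets, and lag \<open>k\<close> is inactive.  The contrapositive of this is the theorem.
\<close>

section \<open>Iterates of an invertible measure-preserving map\<close>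

lemma iter_0 [simp]: "iter M \<theta> 0 \<omega> = \<omega>"
  by (simp add: iter_def)

lemma invertible_mpt_inverse:
  assumes "invertible_mpt M \<theta>" "\<omega> \<in> space M"
  shows "\<theta> \<omega> \<in> space M" "the_inv_into (space M) \<theta> \<omega> \<in> space M"
    and "\<theta> (the_inv_into (space M) \<theta> \<omega>) = \<omega>" "the_inv_into (space M) \<theta> (\<theta> \<omega>) = \<omega>"
proof -
  have bij: "bij_betw \<theta> (space M) (space M)"
    using assms(1) by (simp add: invertible_mpt_def)
  show "\<theta> \<omega> \<in> space M"
    using bij assms(2) by (meson bij_betwE)
  show "the_inv_into (space M) \<theta> \<omega> \<in> space M"
    using bij_betw_the_inv_into[OF bij] assms(2) by (meson bij_betwE)
  show "\<theta> (the_inv_into (space M) \<theta> \<omega>) = \<omega>"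
    using bij assms(2) by (meson f_the_inv_into_f_bij_betw)
  show "the_inv_into (space M) \<theta> (\<theta> \<omega>) = \<omega>"
    using bij assms(2) by (meson bij_betw_imp_inj_on the_inv_into_f_f)
qed

lemma distr_funpow_eq:
  assumes f: "f \<in> M \<rightarrow>\<^sub>M M" and "distr M M f = M"
  shows "distr M M (f ^^ n) = M"
proof (induction n)
  case 0
  show ?case
    by (simp add: distr_id2 id_def)
next
  case (Suc n)
  have "distr M M (f ^^ Suc n) = distr (distr M M (f ^^ n)) M f"
    using f by (subst distr_distr) (auto intro: measurable_compose_n)
  then show ?case
    by (simp only: Suc assms(2))
qed

lemma iter_measurable:
  assumes "invertible_mpt M \<theta>"
  shows "iter M \<theta> a \<in> M \<rightarrow>\<^sub>M M"
  using assms by (auto simp: iter_def invertible_mpt_def intro: measurable_compose_n)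

lemma iter_in_space:
  assumes "invertible_mpt M \<theta>" "\<omega> \<in> space M"
  shows "iter M \<theta> a \<omega> \<in> space M"
  using iter_measurable[OF assms(1)] assms(2) by (rule measurable_space)

lemma distr_iter:
  assumes "invertible_mpt M \<theta>"
  shows "distr M M (iter M \<theta> a) = M"
proof -
  let ?g = "the_inv_into (space M) \<theta>"
  have \<theta>: "\<theta> \<in> M \<rightarrow>\<^sub>M M" "?g \<in> M \<rightarrow>\<^sub>M M" "distr M M \<theta> = M"
    using assms by (auto simp: invertible_mpt_def)
  have "distr M M ?g = distr (distr M M \<theta>) M ?g"
    using \<theta> by simp
  also have "\<dots> = distr M M (?g \<circ> \<theta>)"
    by (rule distr_distr[OF \<theta>(2,1)])
  also have "\<dots> = distr M M (\<lambda>x. x)"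
    using invertible_mpt_inverse[OF assms] by (intro distr_cong) auto
  finally have "distr M M ?g = M"
    by (simp add: distr_id2)
  then show ?thesis
    using \<theta> by (auto simp: iter_def intro!: distr_funpow_eq)
qed

lemma AE_iter:
  assumes "invertible_mpt M \<theta>" "AE \<omega> in M. P \<omega>"
  shows "AE \<omega> in M. P (iter M \<theta> a \<omega>)"
  by (rule AE_distrD[OF iter_measurable[OF assms(1)]])
    (simp only: distr_iter[OF assms(1)], rule assms(2))

lemma iter_Suc:
  assumes "invertible_mpt M \<theta>" "\<omega> \<in> space M"
  shows "iter M \<theta> (a + 1) \<omega> = \<theta> (iter M \<theta> a \<omega>)"
proof (cases "a \<ge> 0")
  case True
  then have "nat (a + 1) = Suc (nat a)"
    by simp
  then show ?thesis
    using True by (simp add: iter_def)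
next
  case False
  then obtain n where n: "nat (- a) = Suc n"
    by (metis gr0_conv_Suc neg_0_less_iff_less not_le zero_less_nat_eq)
  then have a: "a = - int n - 1"
    by linarith
  have "(the_inv_into (space M) \<theta> ^^ n) \<omega> \<in> space M"
    using invertible_mpt_inverse(2)[OF assms(1)] assms(2) by (induction n) auto
  then show ?thesis
    using a n invertible_mpt_inverse(3)[OF assms(1)] by (auto simp: iter_def)
qed

lemma iter_add:
  assumes "invertible_mpt M \<theta>" "\<omega> \<in> space M"
  shows "iter M \<theta> a (iter M \<theta> b \<omega>) = iter M \<theta> (a + b) \<omega>"
proof (induction a rule: int_induct[where k = 0])
  case base
  show ?case by simp
next
  case (step1 i)
  have "iter M \<theta> (i + 1 + b) \<omega> = \<theta> (iter M \<theta> (i + b) \<omega>)"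
    using iter_Suc[OF assms, of "i + b"] by (simp add: algebra_simps)
  then show ?case
    using step1 by (simp add: iter_Suc iter_in_space assms)
next
  case (step2 i)
  let ?g = "the_inv_into (space M) \<theta>"
  have pred: "iter M \<theta> (c - 1) \<xi> = ?g (iter M \<theta> c \<xi>)" if "\<xi> \<in> space M" for c \<xi>
    using iter_Suc[OF assms(1) that, of "c - 1"]
      invertible_mpt_inverse(4)[OF assms(1) iter_in_space[OF assms(1) that]] by simp
  have "iter M \<theta> (i - 1 + b) \<omega> = ?g (iter M \<theta> (i + b) \<omega>)"
    using pred[OF assms(2), of "i + b"] by (simp add: algebra_simps)
  then show ?case
    using step2 pred[OF iter_in_space[OF assms]] by simp
qed

section \<open>Covering by sets with disjoint translates\<close>

text \<open>A countable base of a Hausdorff topology separates points.\<close>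

lemma standard_borel_space_separating:
  assumes "standard_borel_space N"
  obtains \<C> where "countable \<C>" "\<C> \<subseteq> sets N"
    "\<And>x y. \<lbrakk>x \<in> space N; y \<in> space N; x \<noteq> y\<rbrakk> \<Longrightarrow> \<exists>U\<in>\<C>. x \<in> U \<and> y \<notin> U"
proof -
  obtain X where X: "topspace X = space N" "completely_metrizable_space X" "second_countable X"
    "sets N = sigma_sets (space N) {U. openin X U}"
    using assms by (auto simp: standard_borel_space_def)
  obtain \<C> where \<C>: "countable \<C>" "\<And>V. V \<in> \<C> \<Longrightarrow> openin X V"
    "\<And>U x. openin X U \<Longrightarrow> x \<in> U \<Longrightarrow> \<exists>V\<in>\<C>. x \<in> V \<and> V \<subseteq> U"
    using X(3) unfolding second_countable_def by metis
  have haus: "Hausdorff_space X"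
    using X(2) by (simp add: completely_metrizable_imp_metrizable_space metrizable_imp_Hausdorff_space)
  have "\<exists>U\<in>\<C>. x \<in> U \<and> y \<notin> U" if xy: "x \<in> space N" "y \<in> space N" "x \<noteq> y" for x y
  proof -
    obtain U V where UV: "openin X U" "x \<in> U" "y \<in> V" "disjnt U V"
      using haus xy X(1) unfolding Hausdorff_space_def by metis
    then obtain W where "W \<in> \<C>" "x \<in> W" "W \<subseteq> U"
      using \<C>(3) by metis
    then show ?thesis
      using UV(3,4) by (auto simp: disjnt_iff)
  qed
  moreover have "\<C> \<subseteq> sets N"
    using \<C>(2) X(4) by auto
  ultimately show thesis
    using that \<C>(1) by blast
qed

text \<open>
  A completion has more measurable sets than the space it completes, so a separating family for
  the uncompleted space serves in both cases of the definition of a standard probability space.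
\<close>

lemma standard_prob_space_separating:
  assumes "standard_prob_space M"
  obtains Z \<C> where "Z \<in> null_sets M" "countable \<C>" "\<C> \<subseteq> sets M"
    "\<And>x y. \<lbrakk>x \<in> space M - Z; y \<in> space M - Z; x \<noteq> y\<rbrakk> \<Longrightarrow> \<exists>U\<in>\<C>. x \<in> U \<and> y \<notin> U"
proof -
  obtain Z where Z: "Z \<in> null_sets M"
    and std: "standard_borel_space (restrict_space M (space M - Z)) \<or>
        (\<exists>N. standard_borel_space N \<and> restrict_space M (space M - Z) = completion N)"
    using assms by (auto simp: standard_prob_space_def)
  let ?R = "restrict_space M (space M - Z)"
  obtain N where N: "standard_borel_space N" "space N = space ?R" "sets N \<subseteq> sets ?R"
    using std by (metis order_refl sets_completionI_sets space_completion subsetI)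
  obtain \<C> where \<C>: "countable \<C>" "\<C> \<subseteq> sets N"
    "\<And>x y. \<lbrakk>x \<in> space N; y \<in> space N; x \<noteq> y\<rbrakk> \<Longrightarrow> \<exists>U\<in>\<C>. x \<in> U \<and> y \<notin> U"
    using standard_borel_space_separating[OF N(1)] by metis
  have "sets ?R \<subseteq> sets M"
    using Z by (auto simp: sets_restrict_space_iff)
  moreover have "space N = space M - Z"
    using N(2) by (auto simp: space_restrict_space)
  ultimately show thesis
    using that[OF Z \<C>(1)] \<C>(2,3) N(3) by (metis order_trans)
qed

text \<open>
  For almost every \<open>\<omega>\<close> the points \<open>\<theta>\<^sup>a \<omega>\<close>, with \<open>a\<close> in \<open>F\<close>, are distinct, so each pair
  \<open>\<theta>\<^sup>a \<omega>\<close>, \<open>\<theta>\<^sup>b \<omega>\<close> is separated by a member of a countable family of sets.  Sorting the points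
  \<open>\<omega>\<close> by the separating sets used gives countably many classes.  Two translates of one class
  are separated by a single set, and so they are disjoint.
\<close>

lemma countable_cover_disjoint_translates:
  assumes M: "standard_prob_space M" "invertible_mpt M \<theta>" and "finite F"
    and free: "\<And>a b. a \<in> F \<Longrightarrow> b \<in> F \<Longrightarrow> a \<noteq> b \<Longrightarrow> AE \<omega> in M. iter M \<theta> a \<omega> \<noteq> iter M \<theta> b \<omega>"
  obtains \<A> where "countable \<A>" "\<A> \<subseteq> sets M" "AE \<omega> in M. \<omega> \<in> \<Union>\<A>"
    "\<And>A a b \<omega> \<omega>'. \<lbrakk>A \<in> \<A>; a \<in> F; b \<in> F; \<omega> \<in> A; \<omega>' \<in> A; iter M \<theta> a \<omega> = iter M \<theta> b \<omega>'\<rbrakk> \<Longrightarrow> a = b"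
proof -
  obtain Z \<C> where Z: "Z \<in> null_sets M" and \<C>: "countable \<C>" "\<C> \<subseteq> sets M"
    and sep: "\<And>x y. \<lbrakk>x \<in> space M - Z; y \<in> space M - Z; x \<noteq> y\<rbrakk> \<Longrightarrow> \<exists>U\<in>\<C>. x \<in> U \<and> y \<notin> U"
    using standard_prob_space_separating[OF M(1)] by metis
  \<comment> \<open>A function \<open>c\<close> assigns to each pair of exponents the set that separates the two translates.\<close>
  define P where "P = {p \<in> F \<times> F. fst p \<noteq> snd p}"
  define A where "A c = {\<omega> \<in> space M. \<forall>p\<in>P. iter M \<theta> (fst p) \<omega> \<in> c p \<and> iter M \<theta> (snd p) \<omega> \<notin> c p}"
    for c
  have P: "finite P"
    using \<open>finite F\<close> by (simp add: P_def)
  show thesis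
  proof
    show "countable (A ` (P \<rightarrow>\<^sub>E \<C>))"
      using P \<C>(1) by (intro countable_image countable_PiE) auto
    have "A c \<in> sets M" if c: "c \<in> P \<rightarrow>\<^sub>E \<C>" for c
    proof -
      have "c p \<in> sets M" if "p \<in> P" for p
        using c that \<C>(2) by auto
      note [measurable] = this iter_measurable[OF M(2)]
      show ?thesis
        unfolding A_def using P by measurable
    qed
    then show "A ` (P \<rightarrow>\<^sub>E \<C>) \<subseteq> sets M"
      by auto
    have "AE \<omega> in M. \<omega> \<notin> Z"
      using Z by (rule AE_not_in)
    then have "AE \<omega> in M. \<forall>a\<in>F. iter M \<theta> a \<omega> \<notin> Z"
      using \<open>finite F\<close> by (intro AE_finite_allI AE_iter[OF M(2), where P = "\<lambda>\<omega>. \<omega> \<notin> Z"])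
    moreover have "AE \<omega> in M. \<forall>p\<in>P. iter M \<theta> (fst p) \<omega> \<noteq> iter M \<theta> (snd p) \<omega>"
      using free by (intro AE_finite_allI[OF P]) (auto simp: P_def)
    ultimately show "AE \<omega> in M. \<omega> \<in> \<Union>(A ` (P \<rightarrow>\<^sub>E \<C>))"
      using AE_space
    proof eventually_elim
      case (elim \<omega>)
      have "\<exists>U\<in>\<C>. iter M \<theta> (fst p) \<omega> \<in> U \<and> iter M \<theta> (snd p) \<omega> \<notin> U" if "p \<in> P" for p
        using that elim by (intro sep) (auto simp: P_def iter_in_space M(2))
      then obtain c where
        c: "\<And>p. p \<in> P \<Longrightarrow> c p \<in> \<C> \<and> iter M \<theta> (fst p) \<omega> \<in> c p \<and> iter M \<theta> (snd p) \<omega> \<notin> c p"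
        by metis
      then have "\<omega> \<in> A (restrict c P)" "restrict c P \<in> P \<rightarrow>\<^sub>E \<C>"
        using elim by (auto simp: A_def)
      then show ?case
        by blast
    qed
    show "a = b" if "B \<in> A ` (P \<rightarrow>\<^sub>E \<C>)" "a \<in> F" "b \<in> F" "\<omega> \<in> B" "\<omega>' \<in> B"
      "iter M \<theta> a \<omega> = iter M \<theta> b \<omega>'" for B a b \<omega> \<omega>'
    proof (rule ccontr)
      assume "a \<noteq> b"
      then have "(a, b) \<in> P"
        using that by (simp add: P_def)
      moreover obtain c where "B = A c"
        using \<open>B \<in> A ` (P \<rightarrow>\<^sub>E \<C>)\<close> by blast
      ultimately have "iter M \<theta> a \<omega> \<in> c (a, b)" "iter M \<theta> b \<omega>' \<notin> c (a, b)"
        using that by (auto simp: A_def)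
      then show False
        using that by simp
    qed
  qed
qed

section \<open>Square integrable functions and gradients\<close>

lemma L2_scaleR:
  assumes "u \<in> L2 M"
  shows "(\<lambda>\<omega>. c *\<^sub>R u \<omega>) \<in> L2 M"
  using assms by (auto simp: L2_def power_mult_distrib)

lemma L2_add:
  assumes "u \<in> L2 M" "v \<in> L2 M"
  shows "(\<lambda>\<omega>. u \<omega> + v \<omega>) \<in> L2 M"
proof -
  have [measurable]: "u \<in> borel_measurable M" "v \<in> borel_measurable M"
    using assms by (auto simp: L2_def)
  have "(norm (u \<omega> + v \<omega>))\<^sup>2 \<le> 2 * (norm (u \<omega>))\<^sup>2 + 2 * (norm (v \<omega>))\<^sup>2" for \<omega>
    using norm_triangle_ineq[of "u \<omega>" "v \<omega>"] sum_squares_bound[of "norm (u \<omega>)" "norm (v \<omega>)"]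
    by (smt (verit) norm_ge_zero power2_sum power_mono)
  moreover have "integrable M (\<lambda>\<omega>. 2 * (norm (u \<omega>))\<^sup>2 + 2 * (norm (v \<omega>))\<^sup>2)"
    using assms by (simp add: L2_def)
  ultimately have "integrable M (\<lambda>\<omega>. (norm (u \<omega> + v \<omega>))\<^sup>2)"
    by (elim Bochner_Integration.integrable_bound) simp_all
  then show ?thesis
    by (simp add: L2_def)
qed

lemma L2_diff:
  assumes "u \<in> L2 M" "v \<in> L2 M"
  shows "(\<lambda>\<omega>. u \<omega> - v \<omega>) \<in> L2 M"
  using L2_add[OF assms(1) L2_scaleR[OF assms(2), of "-1"]] by simp

lemma L2_indicator:
  assumes "u \<in> L2 M" "A \<in> sets M"
  shows "(\<lambda>\<omega>. indicator A \<omega> *\<^sub>R u \<omega>) \<in> L2 M"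
proof -
  have "(\<lambda>\<omega>. (norm (indicat_real A \<omega> *\<^sub>R u \<omega>))\<^sup>2) = (\<lambda>\<omega>. indicator A \<omega> *\<^sub>R (norm (u \<omega>))\<^sup>2)"
    by (auto simp: indicator_def)
  moreover have "(\<lambda>\<omega>. indicat_real A \<omega> *\<^sub>R u \<omega>) \<in> borel_measurable M"
    using assms by (intro borel_measurable_scaleR) (auto simp: L2_def)
  ultimately show ?thesis
    using assms integrable_mult_indicator[of A M "\<lambda>\<omega>. (norm (u \<omega>))\<^sup>2"] by (simp add: L2_def)
qed

lemma (in finite_measure) L2_const: "(\<lambda>\<omega>. c) \<in> L2 M"
  by (simp add: L2_def)

lemma L2_sum:
  assumes "finite I" "\<And>i. i \<in> I \<Longrightarrow> f i \<in> L2 M"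
  shows "(\<lambda>\<omega>. \<Sum>i\<in>I. f i \<omega>) \<in> L2 M"
  using assms
proof (induction I rule: finite_induct)
  case empty
  show ?case by (simp add: L2_def)
next
  case (insert i I)
  then show ?case by (simp add: L2_add)
qed

lemma L2_inner_integrable:
  assumes "u \<in> L2 M" "v \<in> L2 M"
  shows "integrable M (\<lambda>\<omega>. u \<omega> \<bullet> v \<omega>)"
proof -
  have [measurable]: "u \<in> borel_measurable M" "v \<in> borel_measurable M"
    using assms by (auto simp: L2_def)
  have "\<bar>u \<omega> \<bullet> v \<omega>\<bar> \<le> (norm (u \<omega>))\<^sup>2 + (norm (v \<omega>))\<^sup>2" for \<omega>
    using Cauchy_Schwarz_ineq2[of "u \<omega>" "v \<omega>"] sum_squares_bound[of "norm (u \<omega>)" "norm (v \<omega>)"]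
      mult_nonneg_nonneg[of "norm (u \<omega>)" "norm (v \<omega>)"] by simp
  moreover have "integrable M (\<lambda>\<omega>. (norm (u \<omega>))\<^sup>2 + (norm (v \<omega>))\<^sup>2)"
    using assms by (simp add: L2_def)
  ultimately show ?thesis
    by (elim Bochner_Integration.integrable_bound) simp_all
qed

lemma L2_inner_scaleR: "L2_inner M u (\<lambda>\<omega>. c *\<^sub>R v \<omega>) = c * L2_inner M u v"
  by (simp add: L2_inner_def)

lemma L2_norm_nonneg: "L2_norm M u \<ge> 0"
  by (simp add: L2_norm_def L2_inner_def)

lemma L2_norm_scaleR: "L2_norm M (\<lambda>\<omega>. c *\<^sub>R u \<omega>) = \<bar>c\<bar> * L2_norm M u"
proof -
  have "L2_inner M (\<lambda>\<omega>. c *\<^sub>R u \<omega>) (\<lambda>\<omega>. c *\<^sub>R u \<omega>) = c\<^sup>2 * L2_inner M u u"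
    by (simp add: L2_inner_def power2_eq_square mult.assoc)
  then show ?thesis
    by (simp add: L2_norm_def real_sqrt_mult)
qed

text \<open>
  Along a line, the Frechet derivative becomes an ordinary one, so that results on real functions
  of one variable apply.
\<close>

lemma has_L2_gradient_directional:
  assumes grad: "has_L2_gradient M \<Psi> (\<lambda>\<omega>. u \<omega> + b *\<^sub>R h \<omega>) g" and h: "h \<in> L2 M"
  shows "((\<lambda>r. \<Psi> (\<lambda>\<omega>. u \<omega> + r *\<^sub>R h \<omega>)) has_real_derivative L2_inner M g h) (at b)"
  unfolding has_field_derivative_def has_derivative_at_alt
proof (intro conjI allI impI)
  show "bounded_linear ((*) (L2_inner M g h))"
    by (rule bounded_linear_mult_right)
  fix e :: real
  assume "e > 0"
  \<comment> \<open>Since \<open>?N\<close> may vanish, \<open>?N + 1\<close> is used wherever it would be a divisor.\<close>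
  let ?N = "L2_norm M h"
  have N: "?N + 1 > 0" "?N \<ge> 0"
    using L2_norm_nonneg[of M h] by auto
  have "e / (?N + 1) > 0"
    using \<open>e > 0\<close> N by simp
  then obtain d where "d > 0" and
    d: "\<And>k. \<lbrakk>k \<in> L2 M; L2_norm M k < d\<rbrakk> \<Longrightarrow>
      \<bar>\<Psi> (\<lambda>\<omega>. (u \<omega> + b *\<^sub>R h \<omega>) + k \<omega>) - \<Psi> (\<lambda>\<omega>. u \<omega> + b *\<^sub>R h \<omega>) - L2_inner M g k\<bar>
        \<le> e / (?N + 1) * L2_norm M k"
    using grad unfolding has_L2_gradient_def by blast
  have "norm (\<Psi> (\<lambda>\<omega>. u \<omega> + y *\<^sub>R h \<omega>) - \<Psi> (\<lambda>\<omega>. u \<omega> + b *\<^sub>R h \<omega>) - L2_inner M g h * (y - b))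
      \<le> e * norm (y - b)" if y: "norm (y - b) < d / (?N + 1)" for y
  proof -
    have "\<bar>y - b\<bar> * ?N \<le> \<bar>y - b\<bar> * (?N + 1)"
      by (simp add: mult_left_mono)
    also have "\<dots> < d"
      using y N by (simp add: pos_less_divide_eq)
    finally have "L2_norm M (\<lambda>\<omega>. (y - b) *\<^sub>R h \<omega>) < d"
      by (simp add: L2_norm_scaleR)
    moreover have "(\<lambda>\<omega>. (u \<omega> + b *\<^sub>R h \<omega>) + (y - b) *\<^sub>R h \<omega>) = (\<lambda>\<omega>. u \<omega> + y *\<^sub>R h \<omega>)"
      by (simp add: algebra_simps)
    ultimately
    have "\<bar>\<Psi> (\<lambda>\<omega>. u \<omega> + y *\<^sub>R h \<omega>) - \<Psi> (\<lambda>\<omega>. u \<omega> + b *\<^sub>R h \<omega>) - L2_inner M g h * (y - b)\<bar>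
        \<le> e / (?N + 1) * (\<bar>y - b\<bar> * ?N)"
      using d[OF L2_scaleR[OF h], of "y - b"]
      by (simp add: L2_norm_scaleR L2_inner_scaleR mult.commute[of _ "y - b"])
    also have "\<dots> \<le> e * \<bar>y - b\<bar>"
      using N \<open>e > 0\<close> by (simp add: field_simps mult_left_mono)
    finally show ?thesis
      by simp
  qed
  then show "\<exists>d>0. \<forall>y. norm (y - b) < d \<longrightarrow>
      norm (\<Psi> (\<lambda>\<omega>. u \<omega> + y *\<^sub>R h \<omega>) - \<Psi> (\<lambda>\<omega>. u \<omega> + b *\<^sub>R h \<omega>) - L2_inner M g h * (y - b))
      \<le> e * norm (y - b)"
    using \<open>d > 0\<close> N by (intro exI[of _ "d / (?N + 1)"]) auto
qed

text \<open>
  By assumption \<open>b \<mapsto> \<Psi> (u + r p + b q) - \<Psi> (u + b q)\<close> has derivative zero, so the increment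
  of \<open>\<Psi>\<close> along \<open>r p\<close> is the same from \<open>u + q\<close> as from \<open>u\<close>.  Differentiating this equality at
  \<open>r = 0\<close> gives the claim.  Only first derivatives of \<open>\<Psi>\<close> enter.
\<close>

lemma gradient_no_one_way_influence:
  assumes grad: "\<And>u. u \<in> L2 M \<Longrightarrow> has_L2_gradient M \<Psi> u (T u)"
    and L2: "u \<in> L2 M" "p \<in> L2 M" "q \<in> L2 M"
    and indep: "\<And>v r. v \<in> L2 M \<Longrightarrow>
      L2_inner M (T (\<lambda>\<omega>. v \<omega> + r *\<^sub>R p \<omega>)) q = L2_inner M (T v) q"
  shows "L2_inner M (T (\<lambda>\<omega>. u \<omega> + q \<omega>)) p = L2_inner M (T u) p"
proof -
  let ?D = "\<lambda>r b. \<Psi> (\<lambda>\<omega>. (u \<omega> + r *\<^sub>R p \<omega>) + b *\<^sub>R q \<omega>) - \<Psi> (\<lambda>\<omega>. u \<omega> + b *\<^sub>R q \<omega>)"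
  have "(?D r has_real_derivative 0) (at b)" for r b
  proof -
    have v: "(\<lambda>\<omega>. u \<omega> + b *\<^sub>R q \<omega>) \<in> L2 M" "(\<lambda>\<omega>. (u \<omega> + r *\<^sub>R p \<omega>) + b *\<^sub>R q \<omega>) \<in> L2 M"
      using L2 by (simp_all add: L2_add L2_scaleR)
    have "T (\<lambda>\<omega>. (u \<omega> + r *\<^sub>R p \<omega>) + b *\<^sub>R q \<omega>) = T (\<lambda>\<omega>. (u \<omega> + b *\<^sub>R q \<omega>) + r *\<^sub>R p \<omega>)"
      by (simp add: algebra_simps)
    then show ?thesis
      using DERIV_diff[OF has_L2_gradient_directional[OF grad[OF v(2)] L2(3)]
          has_L2_gradient_directional[OF grad[OF v(1)] L2(3)]] indep[OF v(1), of r]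
      by simp
  qed
  then have const: "?D r 1 = ?D r 0" for r
    using DERIV_isconst_all by blast
  have "(\<lambda>r. \<Psi> (\<lambda>\<omega>. (u \<omega> + q \<omega>) + r *\<^sub>R p \<omega>)) =
      (\<lambda>r. \<Psi> (\<lambda>\<omega>. u \<omega> + r *\<^sub>R p \<omega>) + (\<Psi> (\<lambda>\<omega>. u \<omega> + q \<omega>) - \<Psi> u))"
    using const by (auto simp: algebra_simps)
  moreover have "((\<lambda>r. \<Psi> (\<lambda>\<omega>. u \<omega> + r *\<^sub>R p \<omega>) + (\<Psi> (\<lambda>\<omega>. u \<omega> + q \<omega>) - \<Psi> u))
      has_real_derivative L2_inner M (T u) p) (at 0)"
    using has_L2_gradient_directional[of M \<Psi> u 0 p "T u"] grad L2
    by (auto intro!: derivative_eq_intros)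
  moreover have "((\<lambda>r. \<Psi> (\<lambda>\<omega>. (u \<omega> + q \<omega>) + r *\<^sub>R p \<omega>)) has_real_derivative
      L2_inner M (T (\<lambda>\<omega>. u \<omega> + q \<omega>)) p) (at 0)"
    using has_L2_gradient_directional[of M \<Psi> "\<lambda>\<omega>. u \<omega> + q \<omega>" 0 p "T (\<lambda>\<omega>. u \<omega> + q \<omega>)"] grad L2
    by (simp add: L2_add)
  ultimately show ?thesis
    by (simp only: DERIV_unique)
qed

section \<open>Inactive lags of a gradient map\<close>

text \<open>Thanks to this, an absent reverse lag needs no separate treatment.\<close>

lemma inactive_lag_not_in:
  fixes t :: "'w \<Rightarrow> (int \<Rightarrow> 'h) \<Rightarrow> 'h"
  assumes "k \<notin> S"
  shows "inactive_lag M S t k"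
  unfolding inactive_lag_def
proof (intro AE_I2 ballI impI)
  fix \<omega> and z z' :: "int \<Rightarrow> 'h"
  assume z: "z \<in> S \<rightarrow>\<^sub>E UNIV" "z' \<in> S \<rightarrow>\<^sub>E UNIV" "\<forall>s\<in>S - {k}. z s = z' s"
  then have "z = z'"
    using assms by (intro PiE_ext[OF z(1,2)]) auto
  then show "t \<omega> z = t \<omega> z'"
    by simp
qed

text \<open>
  The background \<open>u\<close> takes the value \<open>z s\<close> on \<open>\<theta>\<^sup>s A\<close>, and \<open>q\<close> on \<open>\<theta>\<^sup>k A\<close> changes coordinate
  \<open>k\<close> from \<open>z k\<close> to \<open>z' k\<close>, so on \<open>A\<close> the two outputs to be compared are \<open>T u\<close> and
  \<open>T (u + q)\<close>.  The test direction \<open>p\<close> is their difference cut off to \<open>A\<close>: no influence of \<open>q\<close>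
  on the component along \<open>p\<close> then means that the squared difference integrates to zero over \<open>A\<close>.
\<close>

lemma gradient_inactive_lag_reverse_on:
  fixes T :: "('w \<Rightarrow> 'h::{real_inner, banach, second_countable_topology}) \<Rightarrow> 'w \<Rightarrow> 'h"
  assumes M: "finite_measure M" "invertible_mpt M \<theta>" "finite S"
    and rep: "caratheodory_rep M \<theta> S T t"
    and grad: "\<And>u. u \<in> L2 M \<Longrightarrow> has_L2_gradient M \<Psi> u (T u)"
    and inactive: "inactive_lag M S t (- k)" and k: "k \<in> S"
    and A: "A \<in> sets M"
    and disj: "\<And>a b \<omega> \<omega>'. \<lbrakk>a \<in> F_set S; b \<in> F_set S; \<omega> \<in> A; \<omega>' \<in> A;
      iter M \<theta> a \<omega> = iter M \<theta> b \<omega>'\<rbrakk> \<Longrightarrow> a = b"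
    and z: "z \<in> S \<rightarrow>\<^sub>E UNIV" "z' \<in> S \<rightarrow>\<^sub>E UNIV" "\<forall>s\<in>S - {k}. z s = z' s"
  shows "AE \<omega> in M. \<omega> \<in> A \<longrightarrow> t \<omega> z = t \<omega> z'"
proof -
  interpret finite_measure M by fact
  let ?\<theta> = "iter M \<theta>"
  \<comment> \<open>\<open>B s\<close> is the translate \<open>\<theta>\<^sup>s A\<close>.\<close>
  define B where "B s = {\<omega> \<in> space M. ?\<theta> (- s) \<omega> \<in> A}" for s
  have B: "B s \<in> sets M" for s
    unfolding B_def using iter_measurable[OF M(2)] A by measurable
  have AM: "\<omega> \<in> space M" if "\<omega> \<in> A" for \<omega>
    using A that sets.sets_into_space by blast
  have B_iff: "?\<theta> r \<omega> \<in> B s \<longleftrightarrow> r = s" if "\<omega> \<in> A" "r \<in> F_set S" "s \<in> F_set S" for r s \<omega>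
  proof
    have \<omega>: "\<omega> \<in> space M"
      using AM that(1) .
    show "?\<theta> r \<omega> \<in> B s" if "r = s"
      using that \<open>\<omega> \<in> A\<close> \<omega> by (simp add: B_def iter_add iter_in_space M(2))
    assume "?\<theta> r \<omega> \<in> B s"
    then have "?\<theta> (r - s) \<omega> \<in> A"
      using \<omega> by (simp add: B_def iter_add M(2))
    moreover have "?\<theta> r \<omega> = ?\<theta> s (?\<theta> (r - s) \<omega>)"
      using \<omega> by (simp add: iter_add M(2))
    ultimately show "r = s"
      using disj that by blast
  qed
  have F: "s \<in> F_set S" if "s \<in> S" for s
    using that by (simp add: F_set_def)
  define u where "u \<omega> = (\<Sum>s\<in>S. indicator (B s) \<omega> *\<^sub>R z s)" for \<omega>
  define q where "q \<omega> = indicator (B k) \<omega> *\<^sub>R (z' k - z k)" for \<omega>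
  define p where "p \<omega> = indicator A \<omega> *\<^sub>R (T (\<lambda>\<omega>. u \<omega> + q \<omega>) \<omega> - T u \<omega>)" for \<omega>
  have T: "T v \<in> L2 M" if "v \<in> L2 M" for v
    using grad[OF that] by (simp add: has_L2_gradient_def)
  have uL2: "u \<in> L2 M"
    unfolding u_def using M(3) B by (intro L2_sum L2_indicator L2_const) auto
  have qL2: "q \<in> L2 M"
    unfolding q_def using B by (intro L2_indicator L2_const)
  have pL2: "p \<in> L2 M"
    unfolding p_def using uL2 qL2 A by (intro L2_indicator L2_diff T L2_add)
  have indep: "L2_inner M (T (\<lambda>\<omega>. v \<omega> + r *\<^sub>R p \<omega>)) q = L2_inner M (T v) q"
    if v: "v \<in> L2 M" for v r
    unfolding L2_inner_def
  proof (rule integral_cong_AE)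
    have w: "(\<lambda>\<omega>. v \<omega> + r *\<^sub>R p \<omega>) \<in> L2 M"
      using v pL2 by (intro L2_add L2_scaleR)
    show "(\<lambda>\<omega>. T (\<lambda>\<omega>. v \<omega> + r *\<^sub>R p \<omega>) \<omega> \<bullet> q \<omega>) \<in> borel_measurable M"
      "(\<lambda>\<omega>. T v \<omega> \<bullet> q \<omega>) \<in> borel_measurable M"
      using L2_inner_integrable[OF T[OF w] qL2] L2_inner_integrable[OF T[OF v] qL2] by auto
    have "AE \<omega> in M. T (\<lambda>\<omega>. v \<omega> + r *\<^sub>R p \<omega>) \<omega> = t \<omega> (\<lambda>s\<in>S. v (?\<theta> s \<omega>) + r *\<^sub>R p (?\<theta> s \<omega>))"
      "AE \<omega> in M. T v \<omega> = t \<omega> (\<lambda>s\<in>S. v (?\<theta> s \<omega>))"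
      using rep v w by (auto simp: caratheodory_rep_def)
    moreover note inactive[unfolded inactive_lag_def]
    ultimately show "AE \<omega> in M. T (\<lambda>\<omega>. v \<omega> + r *\<^sub>R p \<omega>) \<omega> \<bullet> q \<omega> = T v \<omega> \<bullet> q \<omega>"
    proof eventually_elim
      case (elim \<omega>)
      show ?case
      proof (cases "\<omega> \<in> B k")
        case False
        then show ?thesis
          by (simp add: q_def)
      next
        case True
        then have \<alpha>: "?\<theta> (- k) \<omega> \<in> A" "\<omega> \<in> space M"
          by (auto simp: B_def)
        \<comment> \<open>From \<open>\<theta>\<^sup>k A\<close> the set \<open>A\<close> is visible through lag \<open>-k\<close> only; this uses disjointness
          for exponents in \<open>S + S\<close> and for \<open>0\<close>.\<close>
        have "p (?\<theta> s \<omega>) = 0" if s: "s \<in> S - {- k}" for s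
        proof -
          have "?\<theta> s \<omega> \<notin> A"
          proof
            assume *: "?\<theta> s \<omega> \<in> A"
            have "?\<theta> (s + k) (?\<theta> (- k) \<omega>) = ?\<theta> 0 (?\<theta> s \<omega>)"
              using \<alpha>(2) by (simp add: iter_add M(2))
            moreover have "s + k \<in> F_set S" "0 \<in> F_set S"
              using s k by (auto simp: F_set_def)
            ultimately have "s + k = 0"
              using disj \<alpha>(1) * by blast
            then show False
              using s by simp
          qed
          then show ?thesis
            by (simp add: p_def)
        qed
        then have "t \<omega> (\<lambda>s\<in>S. v (?\<theta> s \<omega>) + r *\<^sub>R p (?\<theta> s \<omega>)) = t \<omega> (\<lambda>s\<in>S. v (?\<theta> s \<omega>))"
          by (intro elim(3)[rule_format]) auto
        then show ?thesis
          using elim by simp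
      qed
    qed
  qed
  have uqL2: "(\<lambda>\<omega>. u \<omega> + q \<omega>) \<in> L2 M"
    using uL2 qL2 by (rule L2_add)
  let ?d = "\<lambda>\<omega>. T (\<lambda>\<omega>. u \<omega> + q \<omega>) \<omega> \<bullet> p \<omega> - T u \<omega> \<bullet> p \<omega>"
  have "L2_inner M (T (\<lambda>\<omega>. u \<omega> + q \<omega>)) p = L2_inner M (T u) p"
    by (rule gradient_no_one_way_influence[OF grad uL2 pL2 qL2 indep])
  moreover have int: "integrable M (\<lambda>\<omega>. T (\<lambda>\<omega>. u \<omega> + q \<omega>) \<omega> \<bullet> p \<omega>)" "integrable M (\<lambda>\<omega>. T u \<omega> \<bullet> p \<omega>)"
    using L2_inner_integrable T uqL2 uL2 pL2 by blast+
  ultimately have "(\<integral>\<omega>. ?d \<omega> \<partial>M) = 0"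
    by (simp add: L2_inner_def)
  moreover have d: "?d \<omega> = indicator A \<omega> * (norm (T (\<lambda>\<omega>. u \<omega> + q \<omega>) \<omega> - T u \<omega>))\<^sup>2" for \<omega>
    by (simp add: p_def power2_norm_eq_inner algebra_simps)
  then have "AE \<omega> in M. 0 \<le> ?d \<omega>"
    by simp
  ultimately have zero: "AE \<omega> in M. ?d \<omega> = 0"
    using int by (subst (asm) integral_nonneg_eq_0_iff_AE) auto
  have "AE \<omega> in M. T u \<omega> = t \<omega> (\<lambda>s\<in>S. u (?\<theta> s \<omega>))"
    "AE \<omega> in M. T (\<lambda>\<omega>. u \<omega> + q \<omega>) \<omega> = t \<omega> (\<lambda>s\<in>S. u (?\<theta> s \<omega>) + q (?\<theta> s \<omega>))"
    using rep uL2 uqL2 by (auto simp: caratheodory_rep_def)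
  with zero show ?thesis
  proof eventually_elim
    case (elim \<omega>)
    show ?case
    proof
      assume \<omega>: "\<omega> \<in> A"
      have us: "u (?\<theta> s \<omega>) = z s" if "s \<in> S" for s
      proof -
        have "u (?\<theta> s \<omega>) = (\<Sum>r\<in>S. if r = s then z r else 0)"
          unfolding u_def using \<omega> that F by (intro sum.cong) (auto simp: B_iff)
        then show ?thesis
          using that M(3) by simp
      qed
      have qs: "q (?\<theta> s \<omega>) = z' s - z s" if "s \<in> S" for s
        unfolding q_def using \<omega> that F k z(3) by (cases "s = k") (auto simp: B_iff)
      have "(\<lambda>s\<in>S. u (?\<theta> s \<omega>)) = z" "(\<lambda>s\<in>S. u (?\<theta> s \<omega>) + q (?\<theta> s \<omega>)) = z'"
        using us qs z by (auto simp: fun_eq_iff restrict_def PiE_def extensional_def)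
      moreover have "T (\<lambda>\<omega>. u \<omega> + q \<omega>) \<omega> = T u \<omega>"
        using elim(1) \<omega> unfolding d by simp
      ultimately show "t \<omega> z = t \<omega> z'"
        using elim by simp
    qed
  qed
qed

text \<open>
  The tuples are approximated coordinatewise by a selection \<open>x l\<close> depending only on the limit
  \<open>l\<close>.  Coordinates in which the two tuples agree therefore get equal approximations, and the
  approximating tuples still differ in coordinate \<open>k\<close> alone.
\<close>

lemma continuous_eq_from_dense:
  fixes f :: "('i \<Rightarrow> 'h::real_normed_vector) \<Rightarrow> 'b::t2_space"
  assumes f: "continuous_map (product_topology (\<lambda>_. euclidean) S) euclidean f"
    and D: "closure D = UNIV"
    and eq: "\<And>z z'. \<lbrakk>z \<in> S \<rightarrow>\<^sub>E D; z' \<in> S \<rightarrow>\<^sub>E D; \<forall>s\<in>S - {k}. z s = z' s\<rbrakk> \<Longrightarrow> f z = f z'"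
    and z: "z \<in> S \<rightarrow>\<^sub>E UNIV" "z' \<in> S \<rightarrow>\<^sub>E UNIV" "\<forall>s\<in>S - {k}. z s = z' s"
  shows "f z = f z'"
proof -
  have "\<exists>x. (\<forall>n. x n \<in> D) \<and> x \<longlonglongrightarrow> l" for l
    using D closure_sequential[of l D] by auto
  then obtain x where x: "\<And>l n. x l n \<in> D" "\<And>l. x l \<longlonglongrightarrow> l"
    by metis
  have lim: "(\<lambda>n. f (\<lambda>s\<in>S. x (w s) n)) \<longlonglongrightarrow> f w" if "w \<in> S \<rightarrow>\<^sub>E UNIV" for w
  proof -
    have "limitin (product_topology (\<lambda>_. euclidean) S) (\<lambda>n. \<lambda>s\<in>S. x (w s) n) w sequentially"
      using that x(2) by (auto simp: limitin_componentwise PiE_def)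
    from continuous_map_limit[OF f this] show ?thesis
      by (simp add: o_def)
  qed
  have "f (\<lambda>s\<in>S. x (z s) n) = f (\<lambda>s\<in>S. x (z' s) n)" for n
    using x(1) z(3) by (intro eq) auto
  then have "(\<lambda>n. f (\<lambda>s\<in>S. x (z s) n)) \<longlonglongrightarrow> f z'"
    using lim[OF z(2)] by simp
  with lim[OF z(1)] show ?thesis
    by (rule LIMSEQ_unique)
qed

lemma gradient_inactive_lag_reverse:
  fixes T :: "('w \<Rightarrow> 'h::{real_inner, banach, second_countable_topology}) \<Rightarrow> 'w \<Rightarrow> 'h"
  assumes M: "standard_prob_space M" "invertible_mpt M \<theta>" "finite S"
    and free: "\<And>a b. a \<in> F_set S \<Longrightarrow> b \<in> F_set S \<Longrightarrow> a \<noteq> b \<Longrightarrow>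
           AE \<omega> in M. iter M \<theta> a \<omega> \<noteq> iter M \<theta> b \<omega>"
    and rep: "caratheodory_rep M \<theta> S T t"
    and grad: "\<And>u. u \<in> L2 M \<Longrightarrow> has_L2_gradient M \<Psi> u (T u)"
    and inactive: "inactive_lag M S t (- k)" and k: "k \<in> S"
  shows "inactive_lag M S t k"
proof -
  interpret prob_space M
    using M(1) by (simp add: standard_prob_space_def)
  have "F_set S = {0} \<union> S \<union> (\<lambda>(s, t). s + t) ` (S \<times> S)"
    by (auto simp: F_set_def)
  then have F: "finite (F_set S)"
    using M(3) by simp
  obtain \<A> where \<A>: "countable \<A>" "\<A> \<subseteq> sets M" "AE \<omega> in M. \<omega> \<in> \<Union>\<A>"
    and disj: "\<And>A a b \<omega> \<omega>'. \<lbrakk>A \<in> \<A>; a \<in> F_set S; b \<in> F_set S; \<omega> \<in> A; \<omega>' \<in> A;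
      iter M \<theta> a \<omega> = iter M \<theta> b \<omega>'\<rbrakk> \<Longrightarrow> a = b"
    using countable_cover_disjoint_translates[OF M(1,2) F free] by blast
  obtain D :: "'h set" where D: "countable D" "\<And>U. open U \<Longrightarrow> U \<noteq> {} \<Longrightarrow> \<exists>d\<in>D. d \<in> U"
    by (rule countable_dense_setE) blast
  have "closure D = UNIV"
    using D(2)[of "- closure D"] closure_subset[of D] by auto
  define Q where "Q = {(z, z') \<in> (S \<rightarrow>\<^sub>E D) \<times> (S \<rightarrow>\<^sub>E D). \<forall>s\<in>S - {k}. z s = z' s}"
  have "countable ((S \<rightarrow>\<^sub>E D) \<times> (S \<rightarrow>\<^sub>E D))"
    using M(3) D(1) by (intro countable_SIGMA countable_PiE) auto
  then have Q: "countable Q"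
    by (rule countable_subset[rotated]) (auto simp: Q_def)
  have "AE \<omega> in M. \<omega> \<in> A \<longrightarrow> t \<omega> (fst w) = t \<omega> (snd w)" if "A \<in> \<A>" "w \<in> Q" for A w
    using that \<A>(2)
    by (intro gradient_inactive_lag_reverse_on[OF finite_measure_axioms M(2,3) rep grad inactive k _ disj])
      (auto simp: Q_def)
  then have "AE \<omega> in M. \<forall>A\<in>\<A>. \<forall>w\<in>Q. \<omega> \<in> A \<longrightarrow> t \<omega> (fst w) = t \<omega> (snd w)"
    by (intro AE_ball_countable' \<A>(1) Q)
  moreover have "AE \<omega> in M. continuous_map (product_topology (\<lambda>_. euclidean) S) euclidean (t \<omega>)"
    using rep by (simp add: caratheodory_rep_def)
  ultimately show ?thesis
    unfolding inactive_lag_def using \<A>(3)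
  proof eventually_elim
    case (elim \<omega>)
    then have "\<forall>w\<in>Q. t \<omega> (fst w) = t \<omega> (snd w)"
      by blast
    then have "t \<omega> z = t \<omega> z'"
      if "z \<in> S \<rightarrow>\<^sub>E D" "z' \<in> S \<rightarrow>\<^sub>E D" "\<forall>s\<in>S - {k}. z s = z' s" for z z'
      using that by (auto simp: Q_def)
    then show ?case
      using continuous_eq_from_dense[OF elim(2) \<open>closure D = UNIV\<close>] by blast
  qed
qed

theorem theorem6p1:
  fixes M :: "'w measure"
    and \<theta> :: "'w \<Rightarrow> 'w"
    and S :: "int set"
    and T :: "('w \<Rightarrow> 'h::{real_inner, banach, second_countable_topology}) \<Rightarrow> 'w \<Rightarrow> 'h"
    and t :: "'w \<Rightarrow> (int \<Rightarrow> 'h) \<Rightarrow> 'h"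
  assumes "standard_prob_space M"
    and "invertible_mpt M \<theta>"
    and "finite S"
    and "\<And>a b. a \<in> F_set S \<Longrightarrow> b \<in> F_set S \<Longrightarrow> a \<noteq> b \<Longrightarrow>
           AE \<omega> in M. iter M \<theta> a \<omega> \<noteq> iter M \<theta> b \<omega>"
    and "finite_memory_map M \<theta> S T"
    and "caratheodory_rep M \<theta> S T t"
    and "\<exists>\<Psi>. L2_C1 M \<Psi> \<and> (\<forall>u\<in>L2 M. has_L2_gradient M \<Psi> u (T u))"
  shows "Act M S t = uminus ` Act M S t \<and>
         (\<forall>k\<in>Act M S t. - k \<in> S \<and> - k \<in> Act M S t)"
proof -
  obtain \<Psi> where grad: "\<And>u. u \<in> L2 M \<Longrightarrow> has_L2_gradient M \<Psi> u (T u)"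
    using assms(7) by blast
  have rev: "- k \<in> Act M S t" if k: "k \<in> Act M S t" for k
  proof (rule ccontr)
    assume "- k \<notin> Act M S t"
    then have inactive: "inactive_lag M S t (- k)"
      using inactive_lag_not_in[of "- k" S M t] by (auto simp: Act_def)
    have "k \<in> S"
      using k by (simp add: Act_def)
    have "inactive_lag M S t k"
      by (rule gradient_inactive_lag_reverse[OF assms(1-3) _ assms(6) _ inactive \<open>k \<in> S\<close>])
        (erule (2) assms(4), erule grad)
    then show False
      using k by (simp add: Act_def)
  qed
  have "Act M S t = uminus ` Act M S t"
  proof (intro set_eqI iffI)
    fix k
    assume "k \<in> Act M S t"
    then show "k \<in> uminus ` Act M S t"
      using rev[of k] by (intro image_eqI[of k uminus "- k"]) simp_all
  next
    fix k
    assume "k \<in> uminus ` Act M S t"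
    then show "k \<in> Act M S t"
      using rev by blast
  qed
  then show ?thesis
    using rev by (auto simp: Act_def)
qed

end
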